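(* The numbers $P_{1^{-3}2^{3}3^{1}6^{-1}}(n)$, defined by $\sum_{n\ge0}P_{1^{-3}2^{3}3^{1}6^{-1}}(n)q^n=\frac{f_2^3f_3}{f_1^3f_6}$, form a $2$-convolutive sequence.
   Context: $f_i:=(q^i;q^i)_\infty=\prod_{k\ge1}(1-q^{ik})$. A sequence $(a_n)_{n\ge0}$ is $m$-convolutive if $\sum_{n\ge0}a_{mn}q^n=\big(\sum_{n\ge0}a_nq^n\big)^m$. *)

theory Defs
  imports "HOL-Computational_Algebra.Formal_Power_Series"
begin

text \<open>f_i = (q^i;q^i)_infinity = prod_{k>=1} (1 - q^{ik}) as a formal power series.
  For i >= 1 the coefficient of q^n only depends on the factors with k <= n,
  so we define the n-th coefficient as that of the finite product over k = 1..n.\<close>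
definition qpoch_f :: "nat \<Rightarrow> rat fps" where
  "qpoch_f i = Abs_fps (\<lambda>n. fps_nth (\<Prod>k\<in>{1..n}. (1 - fps_X ^ (i * k))) n)"

definition convolutive :: "nat \<Rightarrow> (nat \<Rightarrow> 'a::comm_ring_1) \<Rightarrow> bool" where
  "convolutive m a \<longleftrightarrow> Abs_fps (\<lambda>n. a (m * n)) = (Abs_fps a) ^ m"

definition P_eta :: "nat \<Rightarrow> rat" where
  "P_eta n = fps_nth (qpoch_f 2 ^ 3 * qpoch_f 3 * inverse (qpoch_f 1 ^ 3 * qpoch_f 6)) n"

end

theory Submission
  imports Defs "HOL-Library.Nat_Bijection"
begin

text \<open>
  Let b(q) = f_1^3/f_3, the cubic theta function of the Borweins, and A = f_2^3 f_3/(f_1^3 f_6),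
  so that A(q) = (f_2^3/f_6)/b(q). Since f_1(q) f_1(-q) f_4 = f_2^3, the product b(q) b(-q) is an
  eta quotient, and A(q) + A(-q) = 2 A(q^2)^2 reduces to b(q) + b(-q) = 2 b(q^4).
  Partial fractions give
  b(q) = 1 + 3 \<Sum>_{n \<ge> 1} (-1)^n q^{n(n+1)/2} (1 + q^n)/(1 + q^n + q^{2n}).
  Expanding this, the coefficient of q^N in b for N \<ge> 1 is three times the sum of \<chi>(u + v)
  over the factorizations N = u v with v odd, where \<chi> is the nontrivial character mod 3. It is
  invariant under N \<mapsto> 4N, and it vanishes for N \<equiv> 2 mod 4 by the involution (2w, v) \<mapsto> (2v, w).
\<close>

unbundle fps_syntax

section \<open>Congruence modulo powers of the variable\<close>

text \<open>Truncated equality f = g + O(X^K). Stated as divisibility, it respects products by ring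
  algebra alone; identities of infinite products are checked on truncations for every K.\<close>

definition fps_cong :: "nat \<Rightarrow> 'a::field fps \<Rightarrow> 'a fps \<Rightarrow> bool" where
  "fps_cong K f g \<longleftrightarrow> fps_X ^ K dvd f - g"

lemma fps_X_power_dvd_iff:
  fixes f :: "'a::field fps"
  shows "fps_X ^ K dvd f \<longleftrightarrow> (\<forall>j<K. f $ j = 0)"
proof
  assume "fps_X ^ K dvd f"
  then show "\<forall>j<K. f $ j = 0" by (auto simp: dvd_def fps_X_power_mult_nth)
next
  assume *: "\<forall>j<K. f $ j = 0"
  have "f = fps_X ^ K * fps_shift K f"
    by (rule fps_ext) (use * in \<open>auto simp: fps_X_power_mult_nth\<close>)
  then show "fps_X ^ K dvd f" by (metis dvd_triv_left)
qed

lemma fps_cong_iff: "fps_cong K f g \<longleftrightarrow> (\<forall>j<K. f $ j = g $ j)"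
  by (simp add: fps_cong_def fps_X_power_dvd_iff)

lemma fps_cong_refl [simp]: "fps_cong K f f"
  by (simp add: fps_cong_iff)

lemma fps_cong_sym: "fps_cong K f g \<Longrightarrow> fps_cong K g f"
  by (simp add: fps_cong_iff)

lemma fps_cong_trans [trans]: "fps_cong K f g \<Longrightarrow> fps_cong K g h \<Longrightarrow> fps_cong K f h"
  by (simp add: fps_cong_iff)

lemma fps_cong_mono: "fps_cong K f g \<Longrightarrow> L \<le> K \<Longrightarrow> fps_cong L f g"
  by (simp add: fps_cong_iff)

lemma fps_cong_add: "fps_cong K f g \<Longrightarrow> fps_cong K f' g' \<Longrightarrow> fps_cong K (f + f') (g + g')"
  by (simp add: fps_cong_iff)

lemma fps_cong_mult:
  assumes "fps_cong K f g" "fps_cong K f' g'"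
  shows "fps_cong K (f * f') (g * g')"
proof -
  have "f * f' - g * g' = (f - g) * f' + g * (f' - g')" by (simp add: algebra_simps)
  with assms show ?thesis unfolding fps_cong_def by (simp only: dvd_add dvd_mult dvd_mult2)
qed

lemma fps_cong_power: "fps_cong K f g \<Longrightarrow> fps_cong K (f ^ n) (g ^ n)"
  by (induction n) (auto intro: fps_cong_mult)

lemma fps_cong_sum: "(\<And>x. x \<in> A \<Longrightarrow> fps_cong K (f x) (g x)) \<Longrightarrow> fps_cong K (sum f A) (sum g A)"
  by (induction A rule: infinite_finite_induct) (auto intro: fps_cong_add)

lemma fps_cong_X_power_mult: "fps_cong K f g \<Longrightarrow> fps_cong (m + K) (fps_X ^ m * f) (fps_X ^ m * g)"
  unfolding fps_cong_iff by (auto simp: fps_X_power_mult_nth)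

text \<open>A series with nonzero constant term is a unit, so it cancels without loss of
  precision.\<close>

lemma fps_cong_cancel:
  assumes "fps_cong K (f * h) (g * h)" "h $ 0 \<noteq> 0"
  shows "fps_cong K f g"
proof -
  have "fps_cong K (f * h * inverse h) (g * h * inverse h)"
    by (intro fps_cong_mult assms) auto
  then show ?thesis using assms(2) by (simp add: mult.assoc inverse_mult_eq_1')
qed

lemma fps_eq_if_cong: "(\<And>K. fps_cong K f g) \<Longrightarrow> f = g"
  unfolding fps_cong_iff by (rule fps_ext) blast

section \<open>Truncated Euler products\<close>

definition qpoch_upto :: "nat \<Rightarrow> nat \<Rightarrow> rat fps" where
  "qpoch_upto i n = (\<Prod>k\<in>{1..n}. (1 - fps_X ^ (i * k)))"

lemma qpoch_upto_0 [simp]: "qpoch_upto i 0 = 1"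
  by (simp add: qpoch_upto_def)

lemma qpoch_upto_Suc: "qpoch_upto i (Suc n) = qpoch_upto i n * (1 - fps_X ^ (i * Suc n))"
  by (simp add: qpoch_upto_def)

lemma qpoch_upto_nth_0 [simp]: "i > 0 \<Longrightarrow> qpoch_upto i n $ 0 = 1"
  by (induction n) (auto simp: qpoch_upto_Suc)

lemma qpoch_upto_nonzero: "i > 0 \<Longrightarrow> qpoch_upto i n \<noteq> 0"
  using qpoch_upto_nth_0[of i n] by fastforce

text \<open>Each extra factor, with k > m, is 1 + O(X^(m+1)) because i * k is at least m +
  1.\<close>

lemma fps_cong_qpoch_upto:
  assumes "i > 0" "m \<le> n"
  shows "fps_cong (Suc m) (qpoch_upto i n) (qpoch_upto i m)"
  using assms(2)
proof (induction n rule: dec_induct)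
  case (step n)
  have "Suc m \<le> i * Suc n" using assms(1) step(1) mult_le_mono[of 1 i "Suc m" "Suc n"] by simp
  then have "fps_cong (Suc m) (1 - fps_X ^ (i * Suc n)) (1 :: rat fps)"
    unfolding fps_cong_iff by auto
  from fps_cong_mult[OF step.IH this] show ?case by (simp add: qpoch_upto_Suc)
qed simp

text \<open>\<open>qpoch_f\<close> reads each coefficient from a different truncation; by stability
  one truncation serves all indices up to n.\<close>

lemma fps_cong_qpoch_f:
  assumes "i > 0"
  shows "fps_cong (Suc n) (qpoch_f i) (qpoch_upto i n)"
  unfolding fps_cong_iff
proof (intro allI impI)
  fix j assume "j < Suc n"
  then have "fps_cong (Suc j) (qpoch_upto i n) (qpoch_upto i j)"
    by (intro fps_cong_qpoch_upto assms) simp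
  then show "qpoch_f i $ j = qpoch_upto i n $ j"
    by (simp add: fps_cong_iff qpoch_f_def qpoch_upto_def)
qed

lemma qpoch_f_nth_0 [simp]: "qpoch_f i $ 0 = 1"
  by (simp add: qpoch_f_def)

lemma qpoch_f_nonzero [simp]: "qpoch_f i \<noteq> 0"
  using qpoch_f_nth_0[of i] by fastforce

section \<open>A finite partial fraction expansion\<close>

text \<open>The ratio of Gaussian binomials [2M, M-n] / [2M, M]; for fixed n it tends to 1 as M
  grows.\<close>

definition qcentral :: "nat \<Rightarrow> nat \<Rightarrow> rat fps" where
  "qcentral M n = qpoch_upto 1 M ^ 2 * inverse (qpoch_upto 1 (M - n) * qpoch_upto 1 (M + n))"

text \<open>The third cyclotomic polynomial at q^n, that is (1 - w q^n)(1 - q^n/w) for a primitive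
  cube root of unity w, kept rational.\<close>

definition cyclo3 :: "nat \<Rightarrow> rat fps" where
  "cyclo3 n = 1 + fps_X ^ n + fps_X ^ (2 * n)"

lemma cyclo3_nth_0: "n > 0 \<Longrightarrow> cyclo3 n $ 0 = 1"
  by (simp add: cyclo3_def)

lemma qcentral_mult:
  assumes "M = n + s"
  shows "qcentral M n * (qpoch_upto 1 s * qpoch_upto 1 (2 * n + s)) = qpoch_upto 1 M ^ 2"
proof -
  have *: "M - n = s" "M + n = 2 * n + s" using assms by simp_all
  show ?thesis unfolding qcentral_def * by (simp add: mult.assoc inverse_mult_eq_1)
qed

lemma qcentral_0_right: "qcentral M 0 = 1"
  by (simp add: qcentral_def power2_eq_square inverse_mult_eq_1')

text \<open>Multiplied by the common denominator \<open>?d\<close>, both sides become the square of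
  \<open>qpoch_upto 1 (m + s + 1)\<close>.\<close>

lemma qcentral_Suc_right:
  "qcentral (m + s + 1) m * (1 - fps_X ^ (s + 1))
     = qcentral (m + s + 1) (m + 1) * (1 - fps_X ^ (2 * m + s + 2))" (is "?l = ?r")
proof -
  let ?d = "qpoch_upto 1 s * qpoch_upto 1 (2 * m + s + 1)"
  have "?l * ?d = qcentral (m + s + 1) m * (qpoch_upto 1 (Suc s) * qpoch_upto 1 (2 * m + Suc s))"
    using qpoch_upto_Suc[of 1 s] by (simp add: mult_ac)
  also have "\<dots> = qpoch_upto 1 (m + s + 1) ^ 2"
    by (rule qcentral_mult) simp
  finally have "?l * ?d = qpoch_upto 1 (m + s + 1) ^ 2" .
  moreover have "?r * ?d = qcentral (m + s + 1) (m + 1) * (qpoch_upto 1 s * qpoch_upto 1 (2 * (m + 1) + s))"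
    using qpoch_upto_Suc[of 1 "2 * m + s + 1"] by (simp add: mult_ac)
  moreover have "\<dots> = qpoch_upto 1 (m + s + 1) ^ 2"
    by (rule qcentral_mult) simp
  ultimately show ?thesis
    using qpoch_upto_nonzero[of 1] by (metis (no_types) mult_right_cancel no_zero_divisors zero_less_one)
qed

text \<open>The same device for a step in the first argument.\<close>

lemma qcentral_Suc_left:
  "qcentral (n + s + 1) n * ((1 - fps_X ^ (s + 1)) * (1 - fps_X ^ (2 * n + s + 1)))
     = (1 - fps_X ^ (n + s + 1)) ^ 2 * qcentral (n + s) n" (is "?l = ?r")
proof -
  let ?d = "qpoch_upto 1 s * qpoch_upto 1 (2 * n + s)"
  have "?l * ?d = qcentral (n + s + 1) n * (qpoch_upto 1 (s + 1) * qpoch_upto 1 (2 * n + s + 1))"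
    using qpoch_upto_Suc[of 1 s] qpoch_upto_Suc[of 1 "2 * n + s"] by (simp add: mult_ac)
  also have "\<dots> = qpoch_upto 1 (n + s + 1) ^ 2"
    using qcentral_mult[of "n + s + 1" n "s + 1"] by (simp add: mult_ac)
  finally have 1: "?l * ?d = qpoch_upto 1 (n + s + 1) ^ 2" .
  have "?r * ?d = (1 - fps_X ^ (n + s + 1)) ^ 2 * qpoch_upto 1 (n + s) ^ 2"
    using qcentral_mult[of "n + s" n s] by (simp add: mult.assoc)
  also have "\<dots> = qpoch_upto 1 (n + s + 1) ^ 2"
    using qpoch_upto_Suc[of 1 "n + s"] by (simp add: power_mult_distrib mult_ac)
  finally show ?thesis
    using 1 qpoch_upto_nonzero[of 1] by (metis (no_types) mult_right_cancel no_zero_divisors zero_less_one)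
qed

text \<open>The partial sums telescope: \<open>qcentral_Suc_right\<close> rewrites the boundary term
  at m through \<open>qcentral M (Suc m)\<close>, where it merges with the new summand. The factor 1
  - X^M avoids a division.\<close>

lemma qcentral_telescope:
  assumes "m \<le> M"
  shows "(1 - fps_X ^ M) * (\<Sum>n<m. (-1) ^ Suc n * qcentral M (Suc n) * fps_X ^ triangle n * (1 + fps_X ^ Suc n))
     = (-1) ^ m * fps_X ^ triangle m * qcentral M m * (1 - fps_X ^ (M - m)) - (1 - fps_X ^ M)"
  using assms
proof (induction m)
  case 0
  then show ?case by (simp add: qcentral_0_right)
next
  case (Suc m)
  then obtain s where M: "M = m + s + 1" by (metis add.commute add_Suc_right Suc_eq_plus1 le_Suc_ex plus_nat.simps(2))
  let ?x = "fps_X :: rat fps"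
  let ?c = "qcentral M (Suc m)" and ?t = "(-1) ^ m * ?x ^ triangle m"
  have ih: "(1 - ?x ^ M) * (\<Sum>n<m. (-1) ^ Suc n * qcentral M (Suc n) * ?x ^ triangle n * (1 + ?x ^ Suc n))
     = ?t * (qcentral M m * (1 - ?x ^ (M - m))) - (1 - ?x ^ M)"
    using Suc by (simp add: mult.assoc)
  have c: "qcentral M m * (1 - ?x ^ (M - m)) = ?c * (1 - ?x ^ (M + m + 1))"
    using qcentral_Suc_right[of m s] by (simp add: M mult_2 ac_simps)
  have key: "(1 - ?x ^ (M + m + 1)) - (1 - ?x ^ M) * (1 + ?x ^ Suc m) = - (?x ^ Suc m * (1 - ?x ^ (M - Suc m)))"
    by (simp add: M algebra_simps power_add)
  have "(1 - ?x ^ M) * (\<Sum>n<Suc m. (-1) ^ Suc n * qcentral M (Suc n) * ?x ^ triangle n * (1 + ?x ^ Suc n))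
     = ?t * (?c * (1 - ?x ^ (M + m + 1))) - (1 - ?x ^ M) - ?t * ?c * ((1 - ?x ^ M) * (1 + ?x ^ Suc m))"
    unfolding sum.lessThan_Suc distrib_left[of "1 - ?x ^ M" "\<Sum>n<m. _ n"] ih c by (simp add: mult_ac)
  also have "\<dots> = ?t * ?c * ((1 - ?x ^ (M + m + 1)) - (1 - ?x ^ M) * (1 + ?x ^ Suc m)) - (1 - ?x ^ M)"
    by (simp add: algebra_simps)
  also have "\<dots> = (-1) ^ Suc m * ?x ^ triangle (Suc m) * ?c * (1 - ?x ^ (M - Suc m)) - (1 - ?x ^ M)"
    unfolding key by (simp add: power_add mult_ac)
  finally show ?case .
qed

text \<open>At m = M the boundary term contains 1 - X^0 = 0. Pairing n with -n, this says that the
  sum of (-1)^n q^(n(n-1)/2) [2M, M+n] over |n| at most M vanishes, the finite triple product at a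
  zero.\<close>

lemma qcentral_alternating_sum:
  assumes "M > 0"
  shows "(\<Sum>n<M. (-1) ^ Suc n * qcentral M (Suc n) * fps_X ^ triangle n * (1 + fps_X ^ Suc n)) = -1" (is "?S = _")
proof -
  have "(1 - fps_X ^ M) * ?S = (1 - fps_X ^ M) * (-1)"
    using qcentral_telescope[of M M] by simp
  moreover have "(1 - fps_X ^ M :: rat fps) $ 0 \<noteq> 0" using assms by simp
  then have "(1 - fps_X ^ M :: rat fps) \<noteq> 0" by (metis fps_zero_nth)
  ultimately show ?thesis using mult_left_cancel by blast
qed

definition borwein_term :: "nat \<Rightarrow> rat fps" where
  "borwein_term n = (-1) ^ n * fps_X ^ triangle n * (1 + fps_X ^ n) * inverse (cyclo3 n)"

text \<open>
  The case x a primitive cube root of unity of the partial fraction expansion in x of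
  \<Prod>_{k \<le> N} (1 - q^k)^2/((1 - x q^k)(1 - q^k/x)). Induction on N works because
  1 + q^M + q^{2M} = (1 - q^{M-n})(1 - q^{M+n}) + q^{M-n} (1 + q^n + q^{2n}).
\<close>

lemma borwein_finite:
  "(1 + 3 * (\<Sum>n<N. qcentral N (Suc n) * borwein_term (Suc n))) * (\<Prod>k\<in>{1..N}. cyclo3 k)
     = qpoch_upto 1 N ^ 2"
proof (induction N)
  case (Suc N)
  let ?x = "fps_X :: rat fps"
  let ?M = "Suc N"
  define t where "t n = (-1) ^ Suc n * qcentral ?M (Suc n) * ?x ^ triangle n * (1 + ?x ^ Suc n)" for n
  let ?u = "\<lambda>N n. qcentral N (Suc n) * borwein_term (Suc n)"
  have cyc: "cyclo3 (Suc n) * borwein_term (Suc n) = (-1) ^ Suc n * ?x ^ triangle (Suc n) * (1 + ?x ^ Suc n)" for n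
  proof -
    have "cyclo3 (Suc n) * inverse (cyclo3 (Suc n)) = 1"
      by (simp add: inverse_mult_eq_1' cyclo3_nth_0)
    then show ?thesis unfolding borwein_term_def by (simp add: mult.left_commute)
  qed
  \<comment> \<open>The cyclotomic denominator cancels, and \<open>triangle (Suc n)\<close> exceeds
    \<open>triangle n\<close> by \<open>Suc n\<close>; the prefactor becomes X^M for every n, so the
    alternating sum applies.\<close>
  have tt: "?x ^ (?M - Suc n) * cyclo3 (Suc n) * ?u ?M n = ?x ^ ?M * t n" if "n < ?M" for n
  proof -
    have "?x ^ (?M - Suc n) * cyclo3 (Suc n) * ?u ?M n
      = ?x ^ (?M - Suc n) * qcentral ?M (Suc n) * (cyclo3 (Suc n) * borwein_term (Suc n))"
      by (simp add: mult_ac)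
    also have "\<dots> = (?x ^ (?M - Suc n) * ?x ^ Suc n) * t n"
      unfolding cyc t_def by (simp add: power_add mult_ac)
    also have "?x ^ (?M - Suc n) * ?x ^ Suc n = ?x ^ ?M"
      using that by (subst power_add[symmetric]) simp
    finally show ?thesis .
  qed
  have step: "cyclo3 ?M * ?u ?M n = (1 - ?x ^ ?M) ^ 2 * ?u N n + ?x ^ ?M * t n" if n: "n < N" for n
  proof -
    obtain s where N: "N = Suc n + s" using n by (metis Suc_leI le_Suc_ex)
    have d: "cyclo3 ?M = (1 - ?x ^ (s + 1)) * (1 - ?x ^ (2 * Suc n + s + 1)) + ?x ^ (?M - Suc n) * cyclo3 (Suc n)"
      by (simp add: N cyclo3_def algebra_simps flip: power_add)
    have q: "qcentral ?M (Suc n) * ((1 - ?x ^ (s + 1)) * (1 - ?x ^ (2 * Suc n + s + 1))) = (1 - ?x ^ ?M) ^ 2 * qcentral N (Suc n)"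
      using qcentral_Suc_left[of "Suc n" s] by (simp add: N)
    have "cyclo3 ?M * ?u ?M n = (qcentral ?M (Suc n) * ((1 - ?x ^ (s + 1)) * (1 - ?x ^ (2 * Suc n + s + 1)))) * borwein_term (Suc n)
        + ?x ^ (?M - Suc n) * cyclo3 (Suc n) * ?u ?M n"
      by (subst d) (simp only: distrib_right distrib_left mult_ac)
    then show ?thesis unfolding q using tt[of n] n by (simp add: mult_ac)
  qed
  \<comment> \<open>The index n = N has no counterpart at level N; there \<open>?M - Suc n\<close>
    is 0, so \<open>tt\<close> alone suffices.\<close>
  have last: "cyclo3 ?M * ?u ?M N = ?x ^ ?M * t N" using tt[of N] by simp
  have "cyclo3 ?M * (\<Sum>n<?M. ?u ?M n)
      = (1 - ?x ^ ?M) ^ 2 * (\<Sum>n<N. ?u N n) + ?x ^ ?M * (\<Sum>n<?M. t n)"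
    by (simp add: distrib_left last sum_distrib_left step sum.distrib)
  also have "(\<Sum>n<?M. t n) = -1"
    using qcentral_alternating_sum[of ?M] by (simp add: t_def)
  finally have s: "cyclo3 ?M * (\<Sum>n<?M. ?u ?M n) = (1 - ?x ^ ?M) ^ 2 * (\<Sum>n<N. ?u N n) - ?x ^ ?M" by simp
  have "cyclo3 ?M * (1 + 3 * (\<Sum>n<?M. ?u ?M n)) = cyclo3 ?M + 3 * (cyclo3 ?M * (\<Sum>n<?M. ?u ?M n))"
    by (simp only: distrib_left mult_1_right mult.left_commute)
  also have "\<dots> = (1 - ?x ^ ?M) ^ 2 * (1 + 3 * (\<Sum>n<N. ?u N n)) + (cyclo3 ?M - 3 * ?x ^ ?M - (1 - ?x ^ ?M) ^ 2)"
    unfolding s by (simp only: algebra_simps mult_1_left)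
  \<comment> \<open>With x = X^M this is 1 + x + x^2 - 3x = (1 - x)^2, which is where the
    coefficient 3 of the sum comes from.\<close>
  also have "cyclo3 ?M - 3 * ?x ^ ?M - (1 - ?x ^ ?M) ^ 2 = 0"
    unfolding cyclo3_def power_even_eq power2_eq_square by (simp add: algebra_simps del: power_Suc)
  finally have main: "cyclo3 ?M * (1 + 3 * (\<Sum>n<?M. ?u ?M n)) = (1 - ?x ^ ?M) ^ 2 * (1 + 3 * (\<Sum>n<N. ?u N n))" by simp
  have "(1 + 3 * (\<Sum>n<?M. ?u ?M n)) * (\<Prod>k\<in>{1..?M}. cyclo3 k)
     = (cyclo3 ?M * (1 + 3 * (\<Sum>n<?M. ?u ?M n))) * (\<Prod>k\<in>{1..N}. cyclo3 k)"
    by (simp add: mult_ac)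
  also have "\<dots> = (1 - ?x ^ ?M) ^ 2 * qpoch_upto 1 N ^ 2"
    unfolding main mult.assoc Suc.IH ..
  also have "\<dots> = qpoch_upto 1 ?M ^ 2"
    by (simp add: qpoch_upto_Suc power_mult_distrib mult_ac)
  finally show ?case .
qed simp

section \<open>The Borwein function\<close>

definition borwein_b :: "rat fps" where
  "borwein_b = qpoch_f 1 ^ 3 * inverse (qpoch_f 3)"

lemma borwein_b_mult: "borwein_b * qpoch_f 3 = qpoch_f 1 ^ 3"
  by (simp add: borwein_b_def mult.assoc inverse_mult_eq_1)

lemma le_triangle: "n \<le> triangle n"
  by (induction n) auto

lemma two_triangle: "2 * triangle n = n * Suc n"
  by (induction n) auto

text \<open>Numerator and denominator both agree with the square of \<open>qpoch_upto 1 s\<close> up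
  to X^s.\<close>

lemma fps_cong_qcentral:
  assumes "M = n + s"
  shows "fps_cong (Suc s) (qcentral M n) 1"
proof (rule fps_cong_cancel)
  let ?h = "qpoch_upto 1 s * qpoch_upto 1 (2 * n + s)"
  have "fps_cong (Suc s) (qpoch_upto 1 M ^ 2) (qpoch_upto 1 s ^ 2)"
    by (intro fps_cong_power fps_cong_qpoch_upto) (use assms in auto)
  also have "fps_cong (Suc s) (qpoch_upto 1 s ^ 2) ?h"
    unfolding power2_eq_square
    by (intro fps_cong_mult fps_cong_refl fps_cong_sym[OF fps_cong_qpoch_upto]) auto
  finally show "fps_cong (Suc s) (qcentral M n * ?h) (1 * ?h)"
    by (simp only: qcentral_mult[OF assms] mult_1_left)
qed simp

text \<open>\<open>qcentral M n\<close> is 1 only up to X^(M-n); the factor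
  X^(\<open>triangle n\<close>) of the term makes up for the missing n.\<close>

lemma fps_cong_qcentral_borwein_term:
  assumes "n \<le> M"
  shows "fps_cong (Suc M) (qcentral M n * borwein_term n) (borwein_term n)"
proof -
  define r where "r = (-1) ^ n * (1 + fps_X ^ n) * inverse (cyclo3 n)"
  have b: "borwein_term n = fps_X ^ triangle n * r"
    by (simp add: borwein_term_def r_def mult_ac)
  have "fps_cong (triangle n + Suc (M - n)) (fps_X ^ triangle n * (qcentral M n * r)) (fps_X ^ triangle n * (1 * r))"
    by (intro fps_cong_X_power_mult fps_cong_mult fps_cong_refl fps_cong_qcentral) (use assms in simp)
  then have "fps_cong (Suc M) (fps_X ^ triangle n * (qcentral M n * r)) (fps_X ^ triangle n * (1 * r))"
    by (rule fps_cong_mono) (use le_triangle[of n] in linarith)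
  then show ?thesis by (simp add: b mult_ac)
qed

lemma prod_cyclo3_mult_qpoch_upto: "(\<Prod>k\<in>{1..N}. cyclo3 k) * qpoch_upto 1 N = qpoch_upto 3 N"
proof -
  have "cyclo3 k * (1 - fps_X ^ (1 * k)) = 1 - fps_X ^ (3 * k)" for k
    by (simp add: cyclo3_def algebra_simps flip: power_add)
  then show ?thesis unfolding qpoch_upto_def by (simp only: prod.distrib[symmetric])
qed

text \<open>The limit of \<open>borwein_finite\<close>: multiplying it by
  \<open>qpoch_upto 1 N\<close> turns the cyclotomic product into a truncation of f_3 and the right
  side into one of f_1^3.\<close>

lemma fps_cong_borwein_b:
  "fps_cong (Suc N) borwein_b (1 + 3 * (\<Sum>n<N. borwein_term (Suc n)))"
proof (rule fps_cong_cancel)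
  let ?S = "1 + 3 * (\<Sum>n<N. qcentral N (Suc n) * borwein_term (Suc n))"
  have "fps_cong (Suc N) (qpoch_f 1 ^ 3) (qpoch_upto 1 N ^ 3)"
    by (intro fps_cong_power fps_cong_qpoch_f) simp
  also have "qpoch_upto 1 N ^ 3 = ?S * ((\<Prod>k\<in>{1..N}. cyclo3 k) * qpoch_upto 1 N)"
    unfolding mult.assoc[symmetric] borwein_finite by (simp add: power3_eq_cube power2_eq_square)
  also have "\<dots> = ?S * qpoch_upto 3 N"
    by (simp only: prod_cyclo3_mult_qpoch_upto)
  also have "fps_cong (Suc N) \<dots> ((1 + 3 * (\<Sum>n<N. borwein_term (Suc n))) * qpoch_f 3)"
    by (intro fps_cong_mult fps_cong_add fps_cong_refl fps_cong_sum fps_cong_qcentral_borwein_term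
        fps_cong_sym[OF fps_cong_qpoch_f]) auto
  finally show "fps_cong (Suc N) (borwein_b * qpoch_f 3) ((1 + 3 * (\<Sum>n<N. borwein_term (Suc n))) * qpoch_f 3)"
    by (simp only: borwein_b_mult)
qed simp

section \<open>Coefficients of the Borwein function as character sums\<close>

definition chi3 :: "int \<Rightarrow> rat" where
  "chi3 k = (if k mod 3 = 1 then 1 else if k mod 3 = 2 then -1 else 0)"

lemma chi3_cong: "3 dvd k - l \<Longrightarrow> chi3 k = chi3 l"
  by (metis chi3_def mod_eq_dvd_iff)

lemma chi3_minus: "3 dvd k + l \<Longrightarrow> chi3 k = - chi3 l"
proof -
  assume "3 dvd k + l"
  then have "k mod 3 = (- (l mod 3)) mod 3" by presburger
  moreover have "l mod 3 = 0 \<or> l mod 3 = 1 \<or> l mod 3 = 2" by presburger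
  ultimately show ?thesis by (auto simp: chi3_def)
qed

text \<open>The three arguments form a complete residue system modulo 3.\<close>

lemma chi3_sum_three: "chi3 (k + 4) + chi3 (k + 2) + chi3 k = 0"
proof -
  have "k mod 3 = 0 \<and> (k + 4) mod 3 = 1 \<and> (k + 2) mod 3 = 2
      \<or> k mod 3 = 1 \<and> (k + 4) mod 3 = 2 \<and> (k + 2) mod 3 = 0
      \<or> k mod 3 = 2 \<and> (k + 4) mod 3 = 0 \<and> (k + 2) mod 3 = 1"
    by presburger
  then show ?thesis unfolding chi3_def by (elim disjE conjE) simp_all
qed

text \<open>With x = X^n this expands (1 + x)/(1 + x + x^2) = (1 - x^2)/(1 - x^3), whose
  coefficients 1, 0, -1 repeat with period 3.\<close>

lemma inverse_cyclo3:
  assumes "n > 0"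
  shows "(1 + fps_X ^ n) * inverse (cyclo3 n)
    = Abs_fps (\<lambda>j. if n dvd j then chi3 (2 * int (j div n) + 1) else 0)" (is "_ = ?H")
proof -
  have H: "?H * cyclo3 n = 1 + fps_X ^ n"
  proof (rule fps_ext)
    fix j
    have c: "(?H * cyclo3 n) $ j = ?H $ j + (if j < n then 0 else ?H $ (j - n)) + (if j < 2 * n then 0 else ?H $ (j - 2 * n))"
      unfolding cyclo3_def distrib_left by (simp only: fps_add_nth fps_X_power_mult_right_nth mult_1_right)
    show "(?H * cyclo3 n) $ j = (1 + fps_X ^ n) $ j"
    proof (cases "n dvd j")
      case False
      then have "\<not> n dvd j - n" if "n \<le> j" using that by (simp add: dvd_minus_self)
      moreover have "\<not> n dvd j - 2 * n" if "2 * n \<le> j"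
        using that False by (metis dvd_add dvd_triv_right le_add_diff_inverse2)
      moreover have "j \<noteq> 0" "j \<noteq> n" using False by (metis dvd_0_right, metis dvd_refl)
      ultimately show ?thesis unfolding c using False by simp
    next
      case True
      then obtain a where a: "j = n * a" by blast
      \<comment> \<open>The numerator 1 + X^n is seen only at j = 0 and j = n; beyond these the
        recurrence \<open>chi3_sum_three\<close> gives zero.\<close>
      consider "a = 0" | "a = 1" | b where "a = b + 2" by (metis add_2_eq_Suc' not0_implies_Suc One_nat_def)
      then show ?thesis
      proof cases
        case 1
        then show ?thesis unfolding c using a assms by (simp add: chi3_def)
      next
        case 2
        then show ?thesis unfolding c using a assms by (simp add: chi3_def)
      next
        case 3
        have "j - n = n * (b + 1)" "j - 2 * n = n * b" "\<not> j < n" "\<not> j < 2 * n"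
          using a 3 by (simp_all add: algebra_simps)
        then have "(?H * cyclo3 n) $ j = chi3 (2 * int (b + 2) + 1) + chi3 (2 * int (b + 1) + 1) + chi3 (2 * int b + 1)"
          unfolding c using a 3 assms by simp
        also have "\<dots> = 0" using chi3_sum_three[of "2 * int b + 1"] by (simp add: algebra_simps)
        finally show ?thesis using a 3 assms by simp
      qed
    qed
  qed
  have "cyclo3 n * inverse (cyclo3 n) = 1"
    using assms by (simp add: inverse_mult_eq_1' cyclo3_nth_0)
  then show ?thesis unfolding H[symmetric] mult.assoc by simp
qed

lemma borwein_term_nth:
  assumes "n > 0"
  shows "borwein_term n $ N = (if triangle n \<le> N \<and> n dvd N - triangle n
    then (-1) ^ n * chi3 (2 * int ((N - triangle n) div n) + 1) else 0)"
proof -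
  define H where "H = (1 + fps_X ^ n) * inverse (cyclo3 n)"
  have "borwein_term n = (-1) ^ n * (fps_X ^ triangle n * H)"
    by (simp add: borwein_term_def H_def mult_ac)
  then have "borwein_term n $ N = (-1) ^ n * ((fps_X ^ triangle n * H) $ N)"
    by (cases "even n") simp_all
  then show ?thesis
    by (auto simp: fps_X_power_mult_nth H_def inverse_cyclo3[OF assms])
qed

definition odd_factorizations :: "nat \<Rightarrow> (nat \<times> nat) set" where
  "odd_factorizations N = {(u, v). u * v = N \<and> odd v}"

text \<open>The n-th term reaches q^N only if N = \<open>triangle n\<close> + n a, that is 2N = n (n
  + 1 + 2a): a factorization of 2N into factors of opposite parity, n being the smaller.\<close>

lemma borwein_b_nth:
  assumes "N > 0"
  shows "borwein_b $ N = 3 * (\<Sum>(u, v)\<in>odd_factorizations N. chi3 (int u + int v))"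
proof -
  define I where "I = {n \<in> {1..N}. triangle n \<le> N \<and> n dvd N - triangle n}"
  define g where "g n = (-1) ^ n * chi3 (2 * int ((N - triangle n) div n) + 1)" for n
  have I_iff: "n \<in> I \<longleftrightarrow> n > 0 \<and> (\<exists>a. 2 * N = n * (n + 1 + 2 * a))" for n
  proof
    assume "n \<in> I"
    then obtain a where "N - triangle n = n * a" "triangle n \<le> N" "n > 0" unfolding I_def by auto
    then have "2 * N = 2 * triangle n + 2 * (n * a)" by linarith
    also have "\<dots> = n * (n + 1 + 2 * a)" unfolding two_triangle by (simp add: algebra_simps)
    finally show "n > 0 \<and> (\<exists>a. 2 * N = n * (n + 1 + 2 * a))" using \<open>n > 0\<close> by blast
  next
    assume "n > 0 \<and> (\<exists>a. 2 * N = n * (n + 1 + 2 * a))"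
    then obtain a where n: "n > 0" and a: "2 * N = n * (n + 1 + 2 * a)" by blast
    from a have "2 * N = 2 * triangle n + 2 * (n * a)" unfolding two_triangle by (simp add: algebra_simps)
    then have "N = triangle n + n * a" by linarith
    then show "n \<in> I" using n le_triangle[of n] unfolding I_def by auto
  qed
  have g_eq: "g n = (-1) ^ n * chi3 (2 * int a + 1)" if "n > 0" "2 * N = n * (n + 1 + 2 * a)" for n a
  proof -
    have "2 * N = 2 * triangle n + 2 * (n * a)" using that unfolding two_triangle by (simp add: algebra_simps)
    then have "N = triangle n + n * a" by linarith
    then show ?thesis using that(1) by (simp add: g_def)
  qed
  have "borwein_b $ N = (1 + 3 * (\<Sum>n<N. borwein_term (Suc n))) $ N"
    using fps_cong_borwein_b[of N] by (simp add: fps_cong_iff)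
  also have "\<dots> = 3 * (\<Sum>n<N. borwein_term (Suc n) $ N)"
    using assms by (simp add: numeral_fps_const fps_sum_nth)
  also have "(\<Sum>n<N. borwein_term (Suc n) $ N) = (\<Sum>n\<in>{1..N}. borwein_term n $ N)"
    by (rule sum.reindex_bij_witness[of _ "\<lambda>n. n - 1" Suc]) auto
  also have "\<dots> = (\<Sum>n\<in>I. g n)"
    by (rule sum.mono_neutral_cong_right) (auto simp: I_def g_def borwein_term_nth)
  \<comment> \<open>Index n corresponds to 2N = n (n + 1 + 2a): exactly one of the two factors is even, and halving it
    yields the factorization (u, v). The sign (-1)^n accounts for n being the even or the odd one.\<close>
  also have "\<dots> = (\<Sum>(u, v)\<in>odd_factorizations N. chi3 (int u + int v))"
  proof (rule sum.reindex_bij_witness[of _ "\<lambda>(u, v). min (2 * u) v"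
        "\<lambda>n. if even n then (n div 2, N div (n div 2)) else (N div n, n)"], goal_cases)
    case (1 n)
    then obtain a where n: "n > 0" and a: "2 * N = n * (n + 1 + 2 * a)" using I_iff by blast
    show ?case
    proof (cases "even n")
      case True
      then obtain u where u: "n = 2 * u" by blast
      have "N = u * (n + 1 + 2 * a)" using a u by simp
      then show ?thesis using n u by simp
    next
      case False
      then have "even (n + 1 + 2 * a)" by simp
      then obtain w where w: "n + 1 + 2 * a = 2 * w" by blast
      have "N = n * w" using a unfolding w by simp
      then show ?thesis using n w False by simp
    qed
  next
    case (2 n)
    then obtain a where n: "n > 0" and a: "2 * N = n * (n + 1 + 2 * a)" using I_iff by blast
    show ?case
    proof (cases "even n")
      case True
      then obtain u where u: "n = 2 * u" by blast
      have "N = u * (n + 1 + 2 * a)" using a u by simp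
      then show ?thesis using n u by (simp add: odd_factorizations_def)
    next
      case False
      then have "even (n + 1 + 2 * a)" by simp
      then obtain w where w: "n + 1 + 2 * a = 2 * w" by blast
      have "N = n * w" using a unfolding w by simp
      then show ?thesis using n False by (simp add: odd_factorizations_def)
    qed
  next
    \<comment> \<open>The index is recovered as the smaller of the factors 2u and v of 2N, which
      differ in parity.\<close>
    case (3 p)
    then obtain u v where p: "p = (u, v)" "u * v = N" "odd v" by (auto simp: odd_factorizations_def)
    then have "u > 0" "v > 0" "2 * u \<noteq> v" using assms by auto
    then show ?case using p by (auto simp: min_def)
  next
    case (4 p)
    then obtain u v where p: "p = (u, v)" "u * v = N" "odd v" by (auto simp: odd_factorizations_def)
    have pos: "u > 0" "v > 0" "2 * u \<noteq> v" using p assms by auto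
    show ?case
    proof (cases "2 * u < v")
      case True
      then have "v = 2 * u + 1 + 2 * ((v - 2 * u - 1) div 2)" using p(3) by presburger
      then have "2 * N = (2 * u) * (2 * u + 1 + 2 * ((v - 2 * u - 1) div 2))" using p(2) by simp
      moreover have "0 < 2 * u" using pos by simp
      ultimately have "2 * u \<in> I" unfolding I_iff by blast
      then show ?thesis using True p by (simp add: min_def)
    next
      case False
      then have "2 * u = v + 1 + 2 * ((2 * u - v - 1) div 2)" using p(3) pos by presburger
      then have "2 * N = v * (v + 1 + 2 * ((2 * u - v - 1) div 2))" using p(2) by (metis mult.assoc mult.commute)
      then have "v \<in> I" unfolding I_iff using pos by blast
      then show ?thesis using False p by (simp add: min_def)
    qed
  next
    case (5 n)
    then obtain a where n: "n > 0" and a: "2 * N = n * (n + 1 + 2 * a)" using I_iff by blast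
    show ?case
    proof (cases "even n")
      case True
      then obtain u where u: "n = 2 * u" by blast
      have N: "N = u * (n + 1 + 2 * a)" using a u by simp
      \<comment> \<open>Since n = 2u, the argument is 3u + 2a + 1.\<close>
      have "chi3 (int u + int (n + 1 + 2 * a)) = chi3 (2 * int a + 1)"
        by (rule chi3_cong) (simp add: u)
      then show ?thesis using n u N g_eq[OF n a] by simp
    next
      case False
      then have "even (n + 1 + 2 * a)" by simp
      then obtain w where w: "n + 1 + 2 * a = 2 * w" by blast
      have N: "N = n * w" using a unfolding w by simp
      have "int n + 1 + 2 * int a = 2 * int w" using w by linarith
      \<comment> \<open>Here (w + n) + (2a + 1) = 3w; the resulting minus sign cancels (-1)^n for
        odd n.\<close>
      then have "chi3 (int w + int n) = - chi3 (2 * int a + 1)"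
        by (intro chi3_minus) presburger
      then show ?thesis using n N False g_eq[OF n a] by simp
    qed
  qed
  finally show ?thesis .
qed

text \<open>As v is odd, the factor 4 must divide u, so (u, v) and (4u, v) correspond; 4 is 1 modulo
  3, so the character value is unchanged.\<close>

lemma borwein_b_nth_4_mult: "borwein_b $ (4 * N) = borwein_b $ N"
proof (cases "N = 0")
  case False
  have "(\<Sum>(u, v)\<in>odd_factorizations N. chi3 (int u + int v))
      = (\<Sum>(u, v)\<in>odd_factorizations (4 * N). chi3 (int u + int v))"
  proof (rule sum.reindex_bij_witness[of _ "\<lambda>(u, v). (u div 4, v)" "\<lambda>(u, v). (4 * u, v)"], goal_cases)
    case (3 p)
    then obtain u v where p: "p = (u, v)" "u * v = 4 * N" "odd v" by (auto simp: odd_factorizations_def)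
    then have "4 dvd u * v" "coprime 4 v" by (auto intro: coprime_power_left_iff[of 2 2 v, simplified, THEN iffD2])
    then have "4 dvd u" by (simp add: coprime_dvd_mult_left_iff)
    then show ?case using p by auto
  next
    case (4 p)
    then obtain u v where p: "p = (u, v)" "u * v = 4 * N" "odd v" by (auto simp: odd_factorizations_def)
    then have "4 dvd u * v" "coprime 4 v" by (auto intro: coprime_power_left_iff[of 2 2 v, simplified, THEN iffD2])
    then have "4 dvd u" by (simp add: coprime_dvd_mult_left_iff)
    then show ?case using p by (auto simp: odd_factorizations_def)
  next
    case (5 p)
    obtain u v where p: "p = (u, v)" by fastforce
    have "chi3 (int (4 * u) + int v) = chi3 (int u + int v)" by (rule chi3_cong) simp
    then show ?case by (simp add: p)
  qed (auto simp: odd_factorizations_def)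
  then show ?thesis using False by (simp add: borwein_b_nth)
qed simp

text \<open>Here u = 2w with w and v odd. The involution flips the sign of the character because (2w
  + v) + (2v + w) = 3(w + v), so the sum equals its own negative.\<close>

lemma borwein_b_nth_4_mult_plus_2: "borwein_b $ (4 * N + 2) = 0"
proof -
  let ?D = "odd_factorizations (4 * N + 2)"
  have D: "even u \<and> odd (u div 2) \<and> (u div 2) * v = 2 * N + 1" if "(u, v) \<in> ?D" for u v
  proof -
    have uv: "u * v = 2 * (2 * N + 1)" "odd v" using that by (auto simp: odd_factorizations_def)
    then have "even u" by (metis dvd_triv_left even_mult_iff)
    then obtain w where "u = 2 * w" by blast
    with uv have "u div 2 = w" "w * v = 2 * N + 1" by auto
    then show ?thesis using \<open>even u\<close> by (metis even_mult_iff even_plus_one_iff dvd_triv_left)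
  qed
  have D': "(2 * v, u div 2) \<in> ?D" if "(u, v) \<in> ?D" for u v
    using D[OF that] by (simp add: odd_factorizations_def mult.assoc mult.commute[of v])
  have "(\<Sum>(u, v)\<in>?D. chi3 (int u + int v)) = (\<Sum>(u, v)\<in>?D. - chi3 (int u + int v))"
  proof (rule sum.reindex_bij_witness[of _ "\<lambda>(u, v). (2 * v, u div 2)" "\<lambda>(u, v). (2 * v, u div 2)"], goal_cases)
    case (5 p)
    obtain u v where p: "p = (u, v)" by fastforce
    then obtain w where w: "u = 2 * w" using D 5 by blast
    have "chi3 (int u + int v) = - chi3 (int (2 * v) + int w)"
      by (rule chi3_minus) (simp add: w)
    then show ?case by (simp add: p w)
  qed (use D D' in auto)
  also have "\<dots> = - (\<Sum>(u, v)\<in>?D. chi3 (int u + int v))"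
    by (simp add: sum_negf case_prod_unfold)
  finally show ?thesis by (simp add: borwein_b_nth)
qed

section \<open>Substitutions\<close>

lemma fps_nth_compose_X_power:
  fixes f :: "'a::comm_ring_1 fps"
  assumes "k > 0"
  shows "(f oo fps_X ^ k) $ n = (if k dvd n then f $ (n div k) else 0)"
proof -
  have "(f oo fps_X ^ k) $ n = (\<Sum>i=0..n. if n = k * i then f $ i else 0)"
    unfolding fps_compose_nth power_mult[symmetric] by (intro sum.cong) auto
  also have "\<dots> = (if k dvd n then f $ (n div k) else 0)"
  proof (cases "k dvd n")
    case True
    then obtain m where m: "n = k * m" by blast
    have "(\<Sum>i=0..n. if n = k * i then f $ i else 0) = (\<Sum>i=0..n. if m = i then f $ i else 0)"
      using assms by (intro sum.cong) (auto simp: m)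
    also have "\<dots> = f $ m" using assms by (simp add: m)
    finally show ?thesis using assms m by simp
  qed (auto intro!: sum.neutral)
  finally show ?thesis .
qed

lemma fps_nth_compose_neg_X:
  fixes f :: "'a::comm_ring_1 fps"
  shows "(f oo - fps_X) $ n = (-1) ^ n * f $ n"
  by (simp add: fps_compose_uminus')

text \<open>Coefficient n of a composition uses only the coefficients of the outer series up to n,
  whatever h is.\<close>

lemma fps_cong_compose: "fps_cong K f g \<Longrightarrow> fps_cong K (f oo h) (g oo h)"
  unfolding fps_cong_iff fps_compose_nth by (intro allI impI sum.cong) auto

lemma qpoch_f_compose_X_power:
  assumes "i > 0" "k > 0"
  shows "qpoch_f i oo fps_X ^ k = qpoch_f (k * i)"
proof (rule fps_eq_if_cong)
  fix K
  have x: "fps_X ^ m oo fps_X ^ k = (fps_X ^ (k * m) :: rat fps)" for m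
    using assms by (simp add: fps_X_power_compose power_mult)
  have "fps_cong (Suc K) (qpoch_f i oo fps_X ^ k) (qpoch_upto i K oo fps_X ^ k)"
    by (intro fps_cong_compose fps_cong_qpoch_f assms)
  also have "qpoch_upto i K oo fps_X ^ k = qpoch_upto (k * i) K"
    unfolding qpoch_upto_def using assms
    by (simp add: fps_compose_prod_distrib fps_compose_sub_distrib x mult.assoc)
  also have "fps_cong (Suc K) (qpoch_upto (k * i) K) (qpoch_f (k * i))"
    by (intro fps_cong_sym[OF fps_cong_qpoch_f]) (use assms in simp)
  finally show "fps_cong K (qpoch_f i oo fps_X ^ k) (qpoch_f (k * i))"
    by (rule fps_cong_mono) simp
qed

text \<open>Each step adds one odd and one even exponent: (1 - y)(1 + y) = 1 - y^2 for the odd one,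
  (1 - z)^2 for the even one. The factor 1 - z^2 still missing from
  \<open>qpoch_upto 2 (2 * Suc N)\<close> is supplied by \<open>qpoch_upto 4\<close>.\<close>

lemma qpoch_upto_mult_compose_neg_X:
  "qpoch_upto 1 (2 * N) * (qpoch_upto 1 (2 * N) oo - fps_X) * qpoch_upto 4 N
     = qpoch_upto 2 N ^ 2 * qpoch_upto 2 (2 * N)"
proof (induction N)
  case (Suc N)
  let ?x = "fps_X :: rat fps"
  let ?p = "qpoch_upto 1 (2 * N)" and ?y = "?x ^ (2 * N + 1)" and ?z = "?x ^ (2 * N + 2)"
  have x: "?x ^ m oo - ?x = (- ?x) ^ m" for m
    by (simp add: fps_X_power_compose)
  have p: "qpoch_upto 1 (2 * Suc N) = ?p * ((1 - ?y) * (1 - ?z))"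
    by (simp add: qpoch_upto_Suc mult_ac)
  have pm: "qpoch_upto 1 (2 * Suc N) oo - ?x = (?p oo - ?x) * ((1 + ?y) * (1 - ?z))"
    unfolding p by (simp add: fps_compose_mult_distrib fps_compose_sub_distrib x)
  have p2: "qpoch_upto 2 (2 * Suc N) = qpoch_upto 2 (2 * N) * ((1 - ?y ^ 2) * (1 - ?z ^ 2))"
    using qpoch_upto_Suc[of 2 "2 * N"] qpoch_upto_Suc[of 2 "2 * N + 1"]
    by (simp add: mult.assoc mult.commute[of _ 2] power_mult[symmetric] del: power_Suc)
  have p4: "qpoch_upto 4 (Suc N) = qpoch_upto 4 N * (1 - ?z ^ 2)"
    using qpoch_upto_Suc[of 4 N]
    by (simp add: mult.commute[of _ 2] power_mult[symmetric] del: power_Suc)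
  have p2': "qpoch_upto 2 (Suc N) = qpoch_upto 2 N * (1 - ?z)"
    by (simp add: qpoch_upto_Suc)
  have "qpoch_upto 1 (2 * Suc N) * (qpoch_upto 1 (2 * Suc N) oo - ?x) * qpoch_upto 4 (Suc N)
     = (?p * (?p oo - ?x) * qpoch_upto 4 N) * (((1 - ?y) * (1 + ?y)) * (1 - ?z) ^ 2 * (1 - ?z ^ 2))"
    unfolding pm p4 unfolding p unfolding power2_eq_square by (simp only: mult_ac)
  also have "(1 - ?y) * (1 + ?y) = 1 - ?y ^ 2"
    by (simp add: power2_eq_square algebra_simps)
  also have "(?p * (?p oo - ?x) * qpoch_upto 4 N) * ((1 - ?y ^ 2) * (1 - ?z) ^ 2 * (1 - ?z ^ 2))
      = qpoch_upto 2 (Suc N) ^ 2 * qpoch_upto 2 (2 * Suc N)"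
    unfolding Suc.IH p2 p2' power_mult_distrib by (simp only: mult_ac)
  finally show ?case .
qed simp

lemma qpoch_f_mult_compose_neg_X:
  "qpoch_f 1 * (qpoch_f 1 oo - fps_X) * qpoch_f 4 = qpoch_f 2 ^ 3"
proof (rule fps_eq_if_cong)
  fix K
  have 1: "fps_cong K (qpoch_f i) (qpoch_upto i n)" if "i > 0" "K \<le> n" for i n
    using fps_cong_mono[OF fps_cong_qpoch_f[OF that(1), of n]] that(2) by simp
  have "fps_cong K (qpoch_f 1 * (qpoch_f 1 oo - fps_X) * qpoch_f 4)
     (qpoch_upto 1 (2 * K) * (qpoch_upto 1 (2 * K) oo - fps_X) * qpoch_upto 4 K)"
    by (intro fps_cong_mult fps_cong_compose 1) auto
  also have "\<dots> = qpoch_upto 2 K ^ 2 * qpoch_upto 2 (2 * K)"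
    by (rule qpoch_upto_mult_compose_neg_X)
  also have "fps_cong K \<dots> (qpoch_f 2 ^ 2 * qpoch_f 2)"
    by (intro fps_cong_mult fps_cong_power fps_cong_sym[OF 1]) auto
  finally show "fps_cong K (qpoch_f 1 * (qpoch_f 1 oo - fps_X) * qpoch_f 4) (qpoch_f 2 ^ 3)"
    by (simp add: power3_eq_cube power2_eq_square)
qed

text \<open>Since 3 is odd, n and n div 3 have the same parity when 3 divides n.\<close>

lemma compose_neg_X_compose_X_cubed:
  fixes f :: "rat fps"
  shows "(f oo fps_X ^ 3) oo - fps_X = (f oo - fps_X) oo fps_X ^ 3"
proof (rule fps_ext)
  fix n
  have "(-1) ^ n = (-1 :: rat) ^ (n div 3)" if "3 dvd n"
    using that by (auto simp: power_mult)
  then show "((f oo fps_X ^ 3) oo - fps_X) $ n = ((f oo - fps_X) oo fps_X ^ 3) $ n"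
    by (auto simp: fps_nth_compose_neg_X fps_nth_compose_X_power)
qed

lemma compose_neg_X_compose_X_squared:
  fixes f :: "rat fps"
  shows "(f oo fps_X ^ 2) oo - fps_X = f oo fps_X ^ 2"
  by (rule fps_ext) (auto simp: fps_nth_compose_neg_X fps_nth_compose_X_power)

text \<open>The left side doubles the even coefficients and kills the odd ones; those at 2 modulo 4
  vanish, and those at 4m equal the m-th.\<close>

lemma borwein_b_plus_compose_neg_X: "borwein_b + (borwein_b oo - fps_X) = 2 * (borwein_b oo fps_X ^ 4)"
proof (rule fps_ext)
  fix n :: nat
  consider m where "n = 4 * m" | m where "n = 4 * m + 2" | "odd n"
  proof -
    have "n = 4 * (n div 4) \<or> n = 4 * (n div 4) + 2 \<or> odd n" by presburger
    then show ?thesis using that by blast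
  qed
  then show "(borwein_b + (borwein_b oo - fps_X)) $ n = (2 * (borwein_b oo fps_X ^ 4)) $ n"
  proof cases
    case (2 m)
    then have "\<not> 4 dvd n" by presburger
    then show ?thesis using 2 borwein_b_nth_4_mult_plus_2[of m]
      by (simp add: fps_nth_compose_neg_X fps_nth_compose_X_power numeral_fps_const)
  next
    case 3
    then have "\<not> 4 dvd n" by presburger
    then show ?thesis using 3 by (simp add: fps_nth_compose_neg_X fps_nth_compose_X_power numeral_fps_const)
  qed (simp add: fps_nth_compose_neg_X fps_nth_compose_X_power numeral_fps_const borwein_b_nth_4_mult)
qed

section \<open>Combining the eta quotients\<close>

text \<open>The g's, \<open>am\<close> and \<open>bm\<close> stand for values at -q,
  \<open>b4\<close> for b(q^4), \<open>a2\<close> for A(q^2). The reason: A(q) + A(-q) = (f2^3/f6)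
  (b + bm)/(b bm), where b + bm = 2 b4 and b bm is an eta quotient.\<close>

lemma eta_quotient_algebra:
  fixes a :: "'a::idom"
  assumes a: "a * (f1 ^ 3 * f6) = f2 ^ 3 * f3" and am: "am * (g1 ^ 3 * f6) = f2 ^ 3 * g3"
    and b: "b * f3 = f1 ^ 3" and bm: "bm * g3 = g1 ^ 3"
    and b4: "b + bm = 2 * b4" "b4 * f12 = f4 ^ 3"
    and fg: "f1 * g1 * f4 = f2 ^ 3" "f3 * g3 * f12 = f6 ^ 3"
    and a2: "a2 * (f2 ^ 3 * f12) = f4 ^ 3 * f6"
    and nz: "f2 \<noteq> 0" "f3 \<noteq> 0" "g3 \<noteq> 0" "f12 \<noteq> 0"
  shows "a + am = 2 * a2 ^ 2"
proof -
  have "(a * b * f6) * f3 = f2 ^ 3 * f3" unfolding a[symmetric] b[symmetric] by (simp only: mult_ac)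
  then have ab: "a * b * f6 = f2 ^ 3" using nz by simp
  have "(am * bm * f6) * g3 = f2 ^ 3 * g3" unfolding am[symmetric] bm[symmetric] by (simp only: mult_ac)
  then have abm: "am * bm * f6 = f2 ^ 3" using nz by simp
  \<comment> \<open>The two identities in \<open>fg\<close>, at q and at q^3, eliminate g1 and
    g3.\<close>
  have "b * bm * f6 ^ 3 * f4 ^ 3 = (b * f3) * (bm * g3) * f12 * f4 ^ 3"
    unfolding fg(2)[symmetric] by (simp only: mult_ac)
  also have "\<dots> = (f1 * g1 * f4) ^ 3 * f12"
    unfolding b bm power_mult_distrib by (simp only: mult_ac)
  finally have bb: "b * bm * f6 ^ 3 * f4 ^ 3 = f2 ^ 9 * f12" unfolding fg by simp
  \<comment> \<open>This multiplier clears all denominators: f2^9 with one f12 becomes b bm f6^3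
    f4^3, and the other f12 is absorbed by b4.\<close>
  have "(a + am) * (f2 ^ 9 * f12 ^ 2) = (a + am) * (f2 ^ 9 * f12) * f12"
    by (simp add: power2_eq_square mult_ac)
  also have "\<dots> = ((a * b * f6) * bm + (am * bm * f6) * b) * (f6 ^ 2 * f4 ^ 3 * f12)"
    unfolding bb[symmetric] by (simp add: power2_eq_square power3_eq_cube algebra_simps)
  also have "\<dots> = f2 ^ 3 * (b + bm) * (f6 ^ 2 * f4 ^ 3 * f12)"
    unfolding ab abm by (simp add: algebra_simps)
  also have "\<dots> = 2 * f2 ^ 3 * (b4 * f12) * (f6 ^ 2 * f4 ^ 3)"
    unfolding b4(1) by (simp only: mult_ac)
  also have "\<dots> = 2 * f2 ^ 3 * (f4 ^ 3 * f6) ^ 2"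
    unfolding b4(2) by (simp add: power2_eq_square mult_ac)
  also have "\<dots> = 2 * a2 ^ 2 * (f2 ^ 9 * f12 ^ 2)"
    unfolding a2[symmetric] by (simp add: power_mult_distrib mult_ac flip: power_mult power_add)
  finally show ?thesis using nz by simp
qed

theorem theorem3p6:
  shows "convolutive 2 P_eta"
proof -
  let ?x = "fps_X :: rat fps"
  define A where "A = qpoch_f 2 ^ 3 * qpoch_f 3 * inverse (qpoch_f 1 ^ 3 * qpoch_f 6)"
  have sub: "qpoch_f i oo ?x ^ k = qpoch_f (k * i)" if "i > 0" "k > 0" for i k
    using qpoch_f_compose_X_power that .
  have mult: "(f * g) oo h = (f oo h) * (g oo h)" and pow: "(f ^ n) oo h = (f oo h) ^ n"
    if "h $ 0 = 0" for f g h :: "rat fps" and n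
    using that by (simp_all add: fps_compose_mult_distrib fps_compose_power)
  have A: "A * (qpoch_f 1 ^ 3 * qpoch_f 6) = qpoch_f 2 ^ 3 * qpoch_f 3"
    by (simp add: A_def mult.assoc inverse_mult_eq_1)
  have even: "qpoch_f 2 oo - ?x = qpoch_f 2" "qpoch_f 6 oo - ?x = qpoch_f 6"
    using compose_neg_X_compose_X_squared[of "qpoch_f 1"] compose_neg_X_compose_X_squared[of "qpoch_f 3"]
    by (simp_all add: sub)
  \<comment> \<open>This makes the product formula for f_1(q) f_1(-q) usable at q^3.\<close>
  have g3: "qpoch_f 3 oo - ?x = (qpoch_f 1 oo - ?x) oo ?x ^ 3"
    using compose_neg_X_compose_X_cubed[of "qpoch_f 1"] by (simp add: sub)
  have "A + (A oo - ?x) = 2 * (A oo ?x ^ 2) ^ 2"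
  proof (rule eta_quotient_algebra[OF A])
    show "(A oo - ?x) * ((qpoch_f 1 oo - ?x) ^ 3 * qpoch_f 6) = qpoch_f 2 ^ 3 * (qpoch_f 3 oo - ?x)"
      using arg_cong[OF A, of "\<lambda>f. f oo - ?x"] by (simp add: mult pow even)
    show "borwein_b * qpoch_f 3 = qpoch_f 1 ^ 3" by (rule borwein_b_mult)
    show "(borwein_b oo - ?x) * (qpoch_f 3 oo - ?x) = (qpoch_f 1 oo - ?x) ^ 3"
      using arg_cong[OF borwein_b_mult, of "\<lambda>f. f oo - ?x"] by (simp add: mult pow)
    show "borwein_b + (borwein_b oo - ?x) = 2 * (borwein_b oo ?x ^ 4)"
      by (rule borwein_b_plus_compose_neg_X)
    show "(borwein_b oo ?x ^ 4) * qpoch_f 12 = qpoch_f 4 ^ 3"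
      using arg_cong[OF borwein_b_mult, of "\<lambda>f. f oo ?x ^ 4"] by (simp add: mult pow sub)
    show "qpoch_f 1 * (qpoch_f 1 oo - ?x) * qpoch_f 4 = qpoch_f 2 ^ 3"
      by (rule qpoch_f_mult_compose_neg_X)
    show "qpoch_f 3 * (qpoch_f 3 oo - ?x) * qpoch_f 12 = qpoch_f 6 ^ 3"
      using arg_cong[OF qpoch_f_mult_compose_neg_X, of "\<lambda>f. f oo ?x ^ 3"] by (simp add: mult pow sub g3)
    show "(A oo ?x ^ 2) * (qpoch_f 2 ^ 3 * qpoch_f 12) = qpoch_f 4 ^ 3 * qpoch_f 6"
      using arg_cong[OF A, of "\<lambda>f. f oo ?x ^ 2"] by (simp add: mult pow sub)
    have "(qpoch_f 3 oo - ?x) $ 0 \<noteq> 0" by simp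
    then show "qpoch_f 3 oo - ?x \<noteq> 0" by (metis fps_zero_nth)
  qed simp_all
  also have "(A oo ?x ^ 2) ^ 2 = A ^ 2 oo ?x ^ 2" by (simp add: pow)
  finally have main: "A + (A oo - ?x) = 2 * (A ^ 2 oo ?x ^ 2)" .
  \<comment> \<open>At even exponents A(q) and A(-q) agree, so comparing coefficients of q^(2n)
    leaves the claim doubled.\<close>
  have "A $ (2 * n) = (A ^ 2) $ n" for n
    using arg_cong[OF main, of "\<lambda>f. f $ (2 * n)"]
    by (simp add: fps_nth_compose_neg_X fps_nth_compose_X_power numeral_fps_const)
  moreover have "P_eta = fps_nth A"
    by (rule ext) (simp only: P_eta_def A_def)
  moreover have "Abs_fps (fps_nth A) = A" by (simp add: fps_eq_iff)
  ultimately show ?thesis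
    by (simp only: convolutive_def) (simp add: fps_eq_iff)
qed

end
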